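(* Let $X$ be a vector lattice and let $(E,\tau)$ be a locally solid vector lattice. Then the operations of addition $(T,S)\mapsto T+S$ and scalar multiplication $(\lambda,T)\mapsto \lambda T$ are continuous in $B_{ob}(X,E)$ with respect to the topology of uniform convergence on order bounded sets.
   Context: All vector spaces are real and operators are linear. A locally solid vector lattice $(E,\tau)$ is a vector lattice $E$ with a linear topology $\tau$ having a base at zero consisting of solid sets. A subset of a vector lattice is order bounded if it is contained in an order interval $[-a,a]=\{x:-a\le x\le a\}$ for some $a\ge 0$. A subset $B\subseteq E$ is ($\tau$-)bounded if for each zero neighborhood $U$ there is a scalar $\lambda>0$ with $B\subseteq\lambda U$. An operator $T:X\to E$ is $ob$-bounded if $T(B)$ is $\tau$-bounded in $E$ for every order bounded set $B\subseteq X$. $B_{ob}(X,E)$ denotes the set of all $ob$-bounded operators from $X$ to $E$; it is a vector space under pointwise operations. A net $(S_\alpha)$ in $B_{ob}(X,E)$ converges to zero uniformly on an order bounded set $B\subseteq X$ if for each zero neighborhood $V$ in $E$ there is an index $\alpha_0$ such that $S_\alpha(B)\subseteq V$ for all $\alpha\ge\alpha_0$. The net $(S_\alpha)$ converges to $S$ uniformly on order bounded sets if $(S_\alpha-S)$ converges to zero uniformly on every order bounded set. The topology of uniform convergence on order bounded sets is the one with this net convergence; continuity of an operation means that it preserves convergence of nets. *)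

theory Defs
  imports "HOL-Analysis.Analysis" "HOL-Library.Lattice_Algebras"
begin

(* The modulus \<bar>x\<bar> = sup x (- x) and its laws come from lattice_ab_group_add_abs. *)
class vector_lattice = ordered_real_vector + lattice_ab_group_add_abs

instance real :: vector_lattice ..

definition solid :: "'e::vector_lattice set \<Rightarrow> bool" where
  "solid A \<longleftrightarrow> (\<forall>x y. x \<in> A \<and> \<bar>y\<bar> \<le> \<bar>x\<bar> \<longrightarrow> y \<in> A)"

(* The Hausdorff property is not part of the definition. *)
definition linear_topology :: "'e::real_vector topology \<Rightarrow> bool" where
  "linear_topology \<tau> \<longleftrightarrow>
     topspace \<tau> = UNIV \<and>
     continuous_map (prod_topology \<tau> \<tau>) \<tau> (\<lambda>(x, y). x + y) \<and>
     continuous_map (prod_topology euclideanreal \<tau>) \<tau> (\<lambda>(r, x). r *\<^sub>R x)"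

definition zero_neighborhood :: "'e::real_vector topology \<Rightarrow> 'e set \<Rightarrow> bool" where
  "zero_neighborhood \<tau> V \<longleftrightarrow> (\<exists>U. openin \<tau> U \<and> 0 \<in> U \<and> U \<subseteq> V)"

definition locally_solid :: "'e::vector_lattice topology \<Rightarrow> bool" where
  "locally_solid \<tau> \<longleftrightarrow>
     linear_topology \<tau> \<and>
     (\<exists>\<B>. (\<forall>V\<in>\<B>. zero_neighborhood \<tau> V \<and> solid V) \<and>
          (\<forall>U. zero_neighborhood \<tau> U \<longrightarrow> (\<exists>V\<in>\<B>. V \<subseteq> U)))"

definition order_bounded :: "'x::vector_lattice set \<Rightarrow> bool" where
  "order_bounded B \<longleftrightarrow> (\<exists>a\<ge>0. B \<subseteq> {-a..a})"

definition top_bounded :: "'e::real_vector topology \<Rightarrow> 'e set \<Rightarrow> bool" where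
  "top_bounded \<tau> B \<longleftrightarrow>
     (\<forall>U. zero_neighborhood \<tau> U \<longrightarrow> (\<exists>r::real. r > 0 \<and> B \<subseteq> (\<lambda>x. r *\<^sub>R x) ` U))"

definition B_ob :: "'e::vector_lattice topology \<Rightarrow> ('x::vector_lattice \<Rightarrow> 'e) set" where
  "B_ob \<tau> = {T. linear T \<and> (\<forall>B. order_bounded B \<longrightarrow> top_bounded \<tau> (T ` B))}"

(* A net is a family indexed by a set D carrying a directed preorder le. *)
definition directed_set :: "'i set \<Rightarrow> ('i \<Rightarrow> 'i \<Rightarrow> bool) \<Rightarrow> bool" where
  "directed_set D le \<longleftrightarrow>
     D \<noteq> {} \<and> reflp_on D le \<and> transp_on D le \<and>
     (\<forall>\<alpha>\<in>D. \<forall>\<beta>\<in>D. \<exists>\<gamma>\<in>D. le \<alpha> \<gamma> \<and> le \<beta> \<gamma>)"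

definition real_net_converges ::
  "'i set \<Rightarrow> ('i \<Rightarrow> 'i \<Rightarrow> bool) \<Rightarrow> ('i \<Rightarrow> real) \<Rightarrow> real \<Rightarrow> bool" where
  "real_net_converges D le r l \<longleftrightarrow>
     (\<forall>e>0. \<exists>\<alpha>\<^sub>0\<in>D. \<forall>\<alpha>\<in>D. le \<alpha>\<^sub>0 \<alpha> \<longrightarrow> \<bar>r \<alpha> - l\<bar> < e)"

definition net_to_zero_uniformly_on ::
  "'e::vector_lattice topology \<Rightarrow> 'i set \<Rightarrow> ('i \<Rightarrow> 'i \<Rightarrow> bool) \<Rightarrow>
     ('i \<Rightarrow> 'x::vector_lattice \<Rightarrow> 'e) \<Rightarrow> 'x set \<Rightarrow> bool" where
  "net_to_zero_uniformly_on \<tau> D le S B \<longleftrightarrow>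
     (\<forall>V. zero_neighborhood \<tau> V \<longrightarrow> (\<exists>\<alpha>\<^sub>0\<in>D. \<forall>\<alpha>\<in>D. le \<alpha>\<^sub>0 \<alpha> \<longrightarrow> S \<alpha> ` B \<subseteq> V))"

(* Convergence in the space B_ob: the terms and the limit are required to lie in it. *)
definition ob_net_converges ::
  "'e::vector_lattice topology \<Rightarrow> 'i set \<Rightarrow> ('i \<Rightarrow> 'i \<Rightarrow> bool) \<Rightarrow>
     ('i \<Rightarrow> 'x::vector_lattice \<Rightarrow> 'e) \<Rightarrow> ('x \<Rightarrow> 'e) \<Rightarrow> bool" where
  "ob_net_converges \<tau> D le S S\<^sub>0 \<longleftrightarrow>
     (\<forall>\<alpha>\<in>D. S \<alpha> \<in> B_ob \<tau>) \<and> S\<^sub>0 \<in> B_ob \<tau> \<and>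
     (\<forall>B. order_bounded B \<longrightarrow> net_to_zero_uniformly_on \<tau> D le (\<lambda>\<alpha> x. S \<alpha> x - S\<^sub>0 x) B)"

end

(*
  In a linear topology a set A is bounded iff every zero neighborhood absorbs it along all
  sufficiently small scalars (of either sign), so boundedness passes to sums and multiples of
  operators. For the scalar multiplication write
  r T - r0 T0 = (r - r0) T0 + r (T - T0): the first term is small because T0 maps order bounded
  sets to bounded ones, the second by joint continuity of the scalar multiplication at (r0, 0).
*)
theory Submission
  imports Defs
begin

section \<open>Zero neighborhoods of a linear topology\<close>

text \<open>Continuity of addition at \<open>(0, 0)\<close>: the preimage of a neighborhood of 0
  contains an open box around \<open>(0, 0)\<close>, and intersecting its two sides gives a single
  \<open>W\<close>.\<close>

lemma zero_neighborhood_add: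
  assumes "linear_topology \<tau>" "zero_neighborhood \<tau> V"
  obtains W where "zero_neighborhood \<tau> W" "\<And>x y. x \<in> W \<Longrightarrow> y \<in> W \<Longrightarrow> x + y \<in> V"
proof -
  obtain U where U: "openin \<tau> U" "0 \<in> U" "U \<subseteq> V"
    using assms(2) by (auto simp: zero_neighborhood_def)
  have top: "topspace \<tau> = UNIV"
    and cont: "continuous_map (prod_topology \<tau> \<tau>) \<tau> (\<lambda>(x, y). x + y)"
    using assms(1) by (auto simp: linear_topology_def)
  have op: "openin (prod_topology \<tau> \<tau>) {p. (case p of (x, y) \<Rightarrow> x + y) \<in> U}"
    using openin_continuous_map_preimage[OF cont U(1)] by (simp add: top)
  have mem: "(0, 0) \<in> {p. (case p of (x, y) \<Rightarrow> x + y) \<in> U}"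
    using U by simp
  obtain A B where AB: "openin \<tau> A" "openin \<tau> B" "0 \<in> A" "0 \<in> B"
      "A \<times> B \<subseteq> {p. (case p of (x, y) \<Rightarrow> x + y) \<in> U}"
    using openin_prod_topology_alt[THEN iffD1, rule_format, OF op mem] by (elim exE conjE)
  show thesis
  proof (rule that[of "A \<inter> B"])
    show "zero_neighborhood \<tau> (A \<inter> B)"
      using AB(1-4) unfolding zero_neighborhood_def by (intro exI[of _ "A \<inter> B"]) auto
    show "x + y \<in> V" if "x \<in> A \<inter> B" "y \<in> A \<inter> B" for x y
      using AB(5) U(3) that by auto
  qed
qed

text \<open>Continuity of scalar multiplication at \<open>(c, 0)\<close>, which is sent to 0. The
  base point \<open>c\<close> is left free: \<open>c = 0\<close> gives absorption of bounded sets,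
  while the limit of a scalar net as \<open>c\<close> controls products with scalars near that
  limit.\<close>

lemma zero_neighborhood_scaleR:
  assumes "linear_topology \<tau>" "zero_neighborhood \<tau> V"
  obtains e W where "e > 0" "zero_neighborhood \<tau> W"
    "\<And>t x. \<bar>t - c\<bar> < e \<Longrightarrow> x \<in> W \<Longrightarrow> t *\<^sub>R x \<in> V"
proof -
  obtain U where U: "openin \<tau> U" "0 \<in> U" "U \<subseteq> V"
    using assms(2) by (auto simp: zero_neighborhood_def)
  have top: "topspace \<tau> = UNIV"
    and cont: "continuous_map (prod_topology euclideanreal \<tau>) \<tau> (\<lambda>(r, x). r *\<^sub>R x)"
    using assms(1) by (auto simp: linear_topology_def)
  have op: "openin (prod_topology euclideanreal \<tau>) {p. (case p of (r, x) \<Rightarrow> r *\<^sub>R x) \<in> U}"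
    using openin_continuous_map_preimage[OF cont U(1)] by (simp add: top)
  have mem: "(c, 0) \<in> {p. (case p of (r, x) \<Rightarrow> r *\<^sub>R x) \<in> U}"
    using U by simp
  obtain A B where AB: "openin euclideanreal A" "openin \<tau> B" "c \<in> A" "0 \<in> B"
      "A \<times> B \<subseteq> {p. (case p of (r, x) \<Rightarrow> r *\<^sub>R x) \<in> U}"
    using openin_prod_topology_alt[THEN iffD1, rule_format, OF op mem] by (elim exE conjE)
  obtain e where e: "e > 0" "\<And>t. \<bar>t - c\<bar> < e \<Longrightarrow> t \<in> A"
    using AB(1,3) unfolding open_openin[symmetric] open_dist dist_real_def by metis
  show thesis
  proof (rule that[OF e(1)])
    show "zero_neighborhood \<tau> B"
      using AB(2,4) unfolding zero_neighborhood_def by blast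
    show "t *\<^sub>R x \<in> V" if "\<bar>t - c\<bar> < e" "x \<in> B" for t x
      using AB(5) U(3) e(2)[OF that(1)] that(2) by auto
  qed
qed

section \<open>Topologically bounded sets\<close>

text \<open>The definition of boundedness supplies one dilation factor, whereas sums and nets call
  for all small scalars at once. Passing to a \<open>W\<close> that all scalars near 0 map into
  \<open>V\<close> bridges the gap.\<close>

lemma top_bounded_iff_absorbed:
  assumes "linear_topology \<tau>"
  shows "top_bounded \<tau> A \<longleftrightarrow>
    (\<forall>V. zero_neighborhood \<tau> V \<longrightarrow> (\<exists>d>0. \<forall>t. \<bar>t\<bar> < d \<longrightarrow> (\<forall>x\<in>A. t *\<^sub>R x \<in> V)))"
    (is "_ \<longleftrightarrow> ?absorbed")
proof
  assume A: "top_bounded \<tau> A"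
  show ?absorbed
  proof (intro allI impI)
    fix V assume "zero_neighborhood \<tau> V"
    \<comment> \<open>This is the instance \<open>c = 0\<close>, hence the shape
      \<open>t - 0\<close>.\<close>
    then obtain e W where W: "e > 0" "zero_neighborhood \<tau> W"
        "\<And>t x. \<bar>t - 0\<bar> < e \<Longrightarrow> x \<in> W \<Longrightarrow> t *\<^sub>R x \<in> V"
      using zero_neighborhood_scaleR[OF assms] by blast
    obtain r where r: "r > 0" "A \<subseteq> (\<lambda>x. r *\<^sub>R x) ` W"
      using A W(2) unfolding top_bounded_def by blast
    have "t *\<^sub>R x \<in> V" if t: "\<bar>t\<bar> < e / r" and x: "x \<in> A" for t x
    proof -
      obtain w where w: "w \<in> W" "x = r *\<^sub>R w" using r(2) x by blast
      \<comment> \<open>The factor \<open>r\<close> coming from \<open>x = r *\<^sub>R w\<close> is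
        absorbed into the scalar, which is why the threshold is \<open>e / r\<close>.\<close>
      have "\<bar>t * r - 0\<bar> < e" using t r(1) by (simp add: abs_mult pos_less_divide_eq)
      from W(3)[OF this w(1)] show ?thesis using w(2) by simp
    qed
    moreover have "e / r > 0" using W(1) r(1) by simp
    ultimately show "\<exists>d>0. \<forall>t. \<bar>t\<bar> < d \<longrightarrow> (\<forall>x\<in>A. t *\<^sub>R x \<in> V)" by blast
  qed
next
  assume abs: ?absorbed
  show "top_bounded \<tau> A"
    unfolding top_bounded_def
  proof (intro allI impI)
    fix V assume "zero_neighborhood \<tau> V"
    then obtain d where d: "d > 0" "\<And>t x. \<bar>t\<bar> < d \<Longrightarrow> x \<in> A \<Longrightarrow> t *\<^sub>R x \<in> V"
      using abs by blast
    \<comment> \<open>Absorption holds for scalars strictly below \<open>d\<close>, so the scalar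
      \<open>d / 2\<close> is chosen; its inverse \<open>2 / d\<close> is the dilation
      factor.\<close>
    have "x \<in> (\<lambda>x. (2 / d) *\<^sub>R x) ` V" if "x \<in> A" for x
      using d(1) d(2)[of "d / 2" x] that by (intro image_eqI[of _ _ "(d / 2) *\<^sub>R x"]) auto
    then show "\<exists>r>0. A \<subseteq> (\<lambda>x. r *\<^sub>R x) ` V"
      using d(1) by (intro exI[of _ "2 / d"]) auto
  qed
qed

text \<open>Dilation factors for the two images may differ and cannot be merged directly; in the
  absorbing form the smaller threshold serves both.\<close>

lemma top_bounded_image_add:
  assumes \<tau>: "linear_topology \<tau>" and "top_bounded \<tau> (f ` B)" "top_bounded \<tau> (g ` B)"
  shows "top_bounded \<tau> ((\<lambda>x. f x + g x) ` B)"
  unfolding top_bounded_iff_absorbed[OF \<tau>]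
proof (intro allI impI)
  fix V assume "zero_neighborhood \<tau> V"
  then obtain W where W: "zero_neighborhood \<tau> W" "\<And>x y. x \<in> W \<Longrightarrow> y \<in> W \<Longrightarrow> x + y \<in> V"
    using zero_neighborhood_add[OF \<tau>] by blast
  obtain d where d: "d > 0" "\<And>t x. \<bar>t\<bar> < d \<Longrightarrow> x \<in> B \<Longrightarrow> t *\<^sub>R f x \<in> W"
    using assms(2) W(1) unfolding top_bounded_iff_absorbed[OF \<tau>] by blast
  obtain d' where d': "d' > 0" "\<And>t x. \<bar>t\<bar> < d' \<Longrightarrow> x \<in> B \<Longrightarrow> t *\<^sub>R g x \<in> W"
    using assms(3) W(1) unfolding top_bounded_iff_absorbed[OF \<tau>] by blast
  show "\<exists>d>0. \<forall>t. \<bar>t\<bar> < d \<longrightarrow> (\<forall>x\<in>(\<lambda>x. f x + g x) ` B. t *\<^sub>R x \<in> V)"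
    using d d' W(2) by (intro exI[of _ "min d d'"]) (auto simp: scaleR_add_right)
qed

text \<open>Multiplication by \<open>c\<close> sends a suitable \<open>W\<close> into
  \<open>V\<close> and commutes with dilation, so a factor \<open>r\<close> for \<open>W\<close>
  also works for \<open>V\<close>. The sign of \<open>c\<close> and the case \<open>c = 0\<close>
  need no separate treatment.\<close>

lemma top_bounded_image_scaleR:
  assumes \<tau>: "linear_topology \<tau>" and "top_bounded \<tau> (f ` B)"
  shows "top_bounded \<tau> ((\<lambda>x. c *\<^sub>R f x) ` B)"
  unfolding top_bounded_def
proof (intro allI impI)
  fix V assume "zero_neighborhood \<tau> V"
  then obtain e W where W: "e > 0" "zero_neighborhood \<tau> W"
      "\<And>t x. \<bar>t - c\<bar> < e \<Longrightarrow> x \<in> W \<Longrightarrow> t *\<^sub>R x \<in> V"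
    using zero_neighborhood_scaleR[OF \<tau>] by blast
  obtain r where r: "r > 0" "f ` B \<subseteq> (\<lambda>x. r *\<^sub>R x) ` W"
    using assms(2) W(2) unfolding top_bounded_def by blast
  have "c *\<^sub>R f x \<in> (\<lambda>x. r *\<^sub>R x) ` V" if x: "x \<in> B" for x
  proof -
    obtain w where "w \<in> W" "f x = r *\<^sub>R w" using r(2) x by blast
    then show ?thesis
      using W(1) W(3)[of c w] by (intro image_eqI[of _ _ "c *\<^sub>R w"]) (auto simp: mult.commute)
  qed
  then show "\<exists>r>0. (\<lambda>x. c *\<^sub>R f x) ` B \<subseteq> (\<lambda>x. r *\<^sub>R x) ` V"
    using r(1) by blast
qed

section \<open>Closure of \<open>B_ob\<close> under the vector space operations\<close>

lemma B_ob_add: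
  assumes "linear_topology \<tau>" "T \<in> B_ob \<tau>" "S \<in> B_ob \<tau>"
  shows "(\<lambda>x. T x + S x) \<in> B_ob \<tau>"
  using assms by (auto simp: B_ob_def intro: linear_compose_add top_bounded_image_add)

lemma B_ob_scaleR:
  assumes "linear_topology \<tau>" "T \<in> B_ob \<tau>"
  shows "(\<lambda>x. c *\<^sub>R T x) \<in> B_ob \<tau>"
  using assms by (auto simp: B_ob_def intro: linear_compose_scale_right top_bounded_image_scaleR)

section \<open>Nets and continuity of the operations\<close>

text \<open>Beyond a common upper bound of the two starting indices both properties hold, by
  transitivity.\<close>

lemma directed_set_eventually_elim2:
  assumes "directed_set D le"
    and "\<exists>\<alpha>\<^sub>0\<in>D. \<forall>\<alpha>\<in>D. le \<alpha>\<^sub>0 \<alpha> \<longrightarrow> P \<alpha>" "\<exists>\<alpha>\<^sub>0\<in>D. \<forall>\<alpha>\<in>D. le \<alpha>\<^sub>0 \<alpha> \<longrightarrow> Q \<alpha>"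
    and "\<And>\<alpha>. P \<alpha> \<Longrightarrow> Q \<alpha> \<Longrightarrow> R \<alpha>"
  shows "\<exists>\<alpha>\<^sub>0\<in>D. \<forall>\<alpha>\<in>D. le \<alpha>\<^sub>0 \<alpha> \<longrightarrow> R \<alpha>"
proof -
  obtain a b where ab: "a \<in> D" "b \<in> D" "\<And>\<alpha>. \<alpha> \<in> D \<Longrightarrow> le a \<alpha> \<Longrightarrow> P \<alpha>"
      "\<And>\<alpha>. \<alpha> \<in> D \<Longrightarrow> le b \<alpha> \<Longrightarrow> Q \<alpha>"
    using assms(2,3) by blast
  obtain c where c: "c \<in> D" "le a c" "le b c"
    using assms(1) ab(1,2) unfolding directed_set_def by blast
  have "transp_on D le" using assms(1) by (simp add: directed_set_def)
  then have "le a \<alpha> \<and> le b \<alpha>" if "\<alpha> \<in> D" "le c \<alpha>" for \<alpha>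
    using ab(1,2) c that by (meson transp_onD)
  then show ?thesis using ab(3,4) c(1) assms(4) by blast
qed

lemma ob_net_converges_add:
  fixes T S :: "'i \<Rightarrow> 'x::vector_lattice \<Rightarrow> 'e::vector_lattice"
  assumes \<tau>: "linear_topology \<tau>" and D: "directed_set D le"
    and T: "ob_net_converges \<tau> D le T T\<^sub>0" and S: "ob_net_converges \<tau> D le S S\<^sub>0"
  shows "ob_net_converges \<tau> D le (\<lambda>\<alpha> x. T \<alpha> x + S \<alpha> x) (\<lambda>x. T\<^sub>0 x + S\<^sub>0 x)"
  unfolding ob_net_converges_def net_to_zero_uniformly_on_def
proof (intro conjI ballI allI impI)
  show "(\<lambda>x. T \<alpha> x + S \<alpha> x) \<in> B_ob \<tau>" if "\<alpha> \<in> D" for \<alpha>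
    using T S that B_ob_add[OF \<tau>] unfolding ob_net_converges_def by blast
  show "(\<lambda>x. T\<^sub>0 x + S\<^sub>0 x) \<in> B_ob \<tau>"
    using T S B_ob_add[OF \<tau>] unfolding ob_net_converges_def by blast
  fix B :: "'x set" and V assume B: "order_bounded B" and "zero_neighborhood \<tau> V"
  then obtain W where W: "zero_neighborhood \<tau> W" "\<And>x y. x \<in> W \<Longrightarrow> y \<in> W \<Longrightarrow> x + y \<in> V"
    using zero_neighborhood_add[OF \<tau>] by blast
  have "\<exists>\<alpha>\<^sub>0\<in>D. \<forall>\<alpha>\<in>D. le \<alpha>\<^sub>0 \<alpha> \<longrightarrow> (\<lambda>x. T \<alpha> x - T\<^sub>0 x) ` B \<subseteq> W"
    using T B W(1) by (simp add: ob_net_converges_def net_to_zero_uniformly_on_def)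
  moreover have "\<exists>\<alpha>\<^sub>0\<in>D. \<forall>\<alpha>\<in>D. le \<alpha>\<^sub>0 \<alpha> \<longrightarrow> (\<lambda>x. S \<alpha> x - S\<^sub>0 x) ` B \<subseteq> W"
    using S B W(1) by (simp add: ob_net_converges_def net_to_zero_uniformly_on_def)
  ultimately show "\<exists>\<alpha>\<^sub>0\<in>D. \<forall>\<alpha>\<in>D. le \<alpha>\<^sub>0 \<alpha> \<longrightarrow>
      (\<lambda>x. T \<alpha> x + S \<alpha> x - (T\<^sub>0 x + S\<^sub>0 x)) ` B \<subseteq> V"
  proof (rule directed_set_eventually_elim2[OF D])
    show "(\<lambda>x. T \<alpha> x + S \<alpha> x - (T\<^sub>0 x + S\<^sub>0 x)) ` B \<subseteq> V"
      if "(\<lambda>x. T \<alpha> x - T\<^sub>0 x) ` B \<subseteq> W" "(\<lambda>x. S \<alpha> x - S\<^sub>0 x) ` B \<subseteq> W" for \<alpha>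
      \<comment> \<open>\<open>add_diff_add\<close> regroups the difference of the sums into the sum
        of the two differences, each lying in \<open>W\<close>.\<close>
      using that W(2) by (auto simp: add_diff_add image_subset_iff)
  qed
qed

lemma ob_net_converges_scaleR:
  fixes T :: "'i \<Rightarrow> 'x::vector_lattice \<Rightarrow> 'e::vector_lattice"
  assumes \<tau>: "linear_topology \<tau>" and D: "directed_set D le"
    and r: "real_net_converges D le r r\<^sub>0" and T: "ob_net_converges \<tau> D le T T\<^sub>0"
  shows "ob_net_converges \<tau> D le (\<lambda>\<alpha> x. r \<alpha> *\<^sub>R T \<alpha> x) (\<lambda>x. r\<^sub>0 *\<^sub>R T\<^sub>0 x)"
  unfolding ob_net_converges_def net_to_zero_uniformly_on_def
proof (intro conjI ballI allI impI)
  show "(\<lambda>x. r \<alpha> *\<^sub>R T \<alpha> x) \<in> B_ob \<tau>" if "\<alpha> \<in> D" for \<alpha>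
    using T that B_ob_scaleR[OF \<tau>] unfolding ob_net_converges_def by blast
  show "(\<lambda>x. r\<^sub>0 *\<^sub>R T\<^sub>0 x) \<in> B_ob \<tau>"
    using T B_ob_scaleR[OF \<tau>] unfolding ob_net_converges_def by blast
  fix B :: "'x set" and V assume B: "order_bounded B" and "zero_neighborhood \<tau> V"
  then obtain W where W: "zero_neighborhood \<tau> W" "\<And>x y. x \<in> W \<Longrightarrow> y \<in> W \<Longrightarrow> x + y \<in> V"
    using zero_neighborhood_add[OF \<tau>] by blast
  \<comment> \<open>Taking \<open>c\<close> to be the limit scalar lets the varying factor
    \<open>r \<alpha>\<close> multiply all of \<open>U\<close> into \<open>W\<close>.\<close>
  obtain e U where U: "e > 0" "zero_neighborhood \<tau> U"
      "\<And>t x. \<bar>t - r\<^sub>0\<bar> < e \<Longrightarrow> x \<in> U \<Longrightarrow> t *\<^sub>R x \<in> W"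
    using zero_neighborhood_scaleR[OF \<tau> W(1)] by blast
  have "top_bounded \<tau> (T\<^sub>0 ` B)"
    using T B by (simp add: ob_net_converges_def B_ob_def)
  then obtain d where d: "d > 0" "\<And>t x. \<bar>t\<bar> < d \<Longrightarrow> x \<in> B \<Longrightarrow> t *\<^sub>R T\<^sub>0 x \<in> W"
    using W(1) unfolding top_bounded_iff_absorbed[OF \<tau>] by blast
  \<comment> \<open>One bound on \<open>r \<alpha> - r\<^sub>0\<close> serves two purposes:
    \<open>d\<close> makes \<open>(r \<alpha> - r\<^sub>0) *\<^sub>R T\<^sub>0 x\<close> small, and
    \<open>e\<close> keeps \<open>r \<alpha>\<close> in the range required for
    \<open>U\<close>.\<close>
  have "min d e > 0" using d(1) U(1) by simp
  then have "\<exists>\<alpha>\<^sub>0\<in>D. \<forall>\<alpha>\<in>D. le \<alpha>\<^sub>0 \<alpha> \<longrightarrow> \<bar>r \<alpha> - r\<^sub>0\<bar> < min d e"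
    by (rule r[unfolded real_net_converges_def, rule_format])
  moreover have "\<exists>\<alpha>\<^sub>0\<in>D. \<forall>\<alpha>\<in>D. le \<alpha>\<^sub>0 \<alpha> \<longrightarrow> (\<lambda>x. T \<alpha> x - T\<^sub>0 x) ` B \<subseteq> U"
    using T B U(2) by (simp add: ob_net_converges_def net_to_zero_uniformly_on_def)
  ultimately show "\<exists>\<alpha>\<^sub>0\<in>D. \<forall>\<alpha>\<in>D. le \<alpha>\<^sub>0 \<alpha> \<longrightarrow>
      (\<lambda>x. r \<alpha> *\<^sub>R T \<alpha> x - r\<^sub>0 *\<^sub>R T\<^sub>0 x) ` B \<subseteq> V"
  proof (rule directed_set_eventually_elim2[OF D], intro image_subsetI)
    fix \<alpha> x
    assume small: "\<bar>r \<alpha> - r\<^sub>0\<bar> < min d e" "(\<lambda>x. T \<alpha> x - T\<^sub>0 x) ` B \<subseteq> U" and x: "x \<in> B"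
    have "(r \<alpha> - r\<^sub>0) *\<^sub>R T\<^sub>0 x + r \<alpha> *\<^sub>R (T \<alpha> x - T\<^sub>0 x) \<in> V"
      using small x by (intro W(2) d(2) U(3)) auto
    then show "r \<alpha> *\<^sub>R T \<alpha> x - r\<^sub>0 *\<^sub>R T\<^sub>0 x \<in> V"
      by (simp add: algebra_simps)
  qed
qed

theorem theorem2p1:
  fixes \<tau> :: "'e::vector_lattice topology"
    and D :: "'i set" and le :: "'i \<Rightarrow> 'i \<Rightarrow> bool"
  assumes "locally_solid \<tau>"
    and "directed_set D le"
  shows "(\<forall>(T :: 'i \<Rightarrow> 'x::vector_lattice \<Rightarrow> 'e) S T\<^sub>0 S\<^sub>0.
            ob_net_converges \<tau> D le T T\<^sub>0 \<and> ob_net_converges \<tau> D le S S\<^sub>0 \<longrightarrow>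
            ob_net_converges \<tau> D le (\<lambda>\<alpha> x. T \<alpha> x + S \<alpha> x) (\<lambda>x. T\<^sub>0 x + S\<^sub>0 x)) \<and>
         (\<forall>(r :: 'i \<Rightarrow> real) (T :: 'i \<Rightarrow> 'x \<Rightarrow> 'e) r\<^sub>0 T\<^sub>0.
            real_net_converges D le r r\<^sub>0 \<and> ob_net_converges \<tau> D le T T\<^sub>0 \<longrightarrow>
            ob_net_converges \<tau> D le (\<lambda>\<alpha> x. r \<alpha> *\<^sub>R T \<alpha> x) (\<lambda>x. r\<^sub>0 *\<^sub>R T\<^sub>0 x))"
proof -
  have "linear_topology \<tau>" using assms(1) by (simp add: locally_solid_def)
  then show ?thesis
    using assms(2) by (intro conjI allI impI; elim conjE)
      (rule ob_net_converges_add ob_net_converges_scaleR; assumption)+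
qed

end
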